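(* Let $(u,v)\in\mathbb{D}\times\mathbb{D}'$ and let $p,q$ be positive integers. Then $$\mathscr{F}\left(\frac pq;u,v\right)=\frac qp\,\mathrm{Li}_2(u)+\sum_{\alpha^p=1}\sum_{\beta^q=1}\left\{\mathrm{Li}_2\left(\frac{\beta v^{1/q}}{\beta v^{1/q}-1}\right)-\mathrm{Li}_2\left(\frac{\alpha u^{1/p}-\beta v^{1/q}}{1-\beta v^{1/q}}\right)\right\},$$ where the sums run over all complex $p$-th roots of unity $\alpha$ and all complex $q$-th roots of unity $\beta$.
   Context: $\mathbb{D}=\{z\in\mathbb{C}\setminus\{0\}:|z|\le1\}$, $\mathbb{D}'=\mathbb{D}\setminus\{1\}$. For $\mathrm{Re}(x)>0$, $u\in\mathbb{C}\setminus(1,\infty)$, $u\ne0$, and $v\in\mathbb{C}\setminus[1,\infty)$, $v\neq0$, $$\mathscr{F}(x;u,v)=\int_0^1\frac{\log(1-ut^x)}{v^{-1}-t}\,dt$$ (principal logarithm). $\mathrm{Li}_2(z)=\sum_{n\ge1}z^n/n^2$ for $|z|\le1$, extended analytically to $\mathbb{C}\setminus[1,\infty)$ (principal branch), with $\mathrm{Li}_2(1)=\pi^2/6$. $u^{1/p}$ and $v^{1/q}$ are any fixed roots (the sums do not depend on the choice). *)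

theory Defs
  imports "HOL-Complex_Analysis.Complex_Analysis"
begin

definition Li2_series :: "complex \<Rightarrow> complex" where
  "Li2_series z = (\<Sum>n. z ^ Suc n / of_nat (Suc n) ^ 2)"

definition slit_plane :: "complex set" where
  "slit_plane = - (complex_of_real ` {1..})"

text \<open>
  The principal branch of the dilogarithm. Outside the closed unit disc it is the value of the
  analytic continuation of the series from the open disc to the plane cut along \<open>[1, \<infinity>)\<close>; this
  value is well defined by \<open>Li2_continuation_exists\<close> and \<open>Li2_continuation_unique\<close>, and
  \<open>Li2_holomorphic\<close> shows that the two clauses fit together. The value at a real \<open>z > 1\<close> is
  an artefact of the definition.
\<close>

definition is_Li2_continuation :: "(complex \<Rightarrow> complex) \<Rightarrow> bool" where
  "is_Li2_continuation f \<longleftrightarrow>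
     f holomorphic_on slit_plane \<and> (\<forall>z\<in>ball 0 1. f z = Li2_series z)"

definition Li2 :: "complex \<Rightarrow> complex" where
  "Li2 z = (if norm z \<le> 1 then Li2_series z else (SOME f. is_Li2_continuation f) z)"

text \<open>
  Here \<open>Ln\<close> is the principal logarithm, and \<open>t powr x\<close> is \<open>exp (x * ln t)\<close> for \<open>t > 0\<close> and
  \<open>0\<close> for \<open>t = 0\<close>. The definition is meant for \<open>Re x > 0\<close>, for \<open>u \<noteq> 0\<close> not in \<open>(1, \<infinity>)\<close> and
  for \<open>v \<noteq> 0\<close> not in \<open>[1, \<infinity>)\<close>.
\<close>

definition scriptF :: "complex \<Rightarrow> complex \<Rightarrow> complex \<Rightarrow> complex" where
  "scriptF x u v =
     integral {0..1} (\<lambda>t::real. Ln (1 - u * of_real t powr x) / (inverse v - of_real t))"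

definition punctured_disc :: "complex set" where
  "punctured_disc = {z. z \<noteq> 0 \<and> norm z \<le> 1}"


lemma mem_slit_plane: "z \<in> slit_plane \<longleftrightarrow> 1 - z \<notin> \<real>\<^sub>\<le>\<^sub>0"
proof -
  have "z \<in> complex_of_real ` {1..} \<longleftrightarrow> 1 - z \<in> \<real>\<^sub>\<le>\<^sub>0"
  proof
    assume "1 - z \<in> \<real>\<^sub>\<le>\<^sub>0"
    then obtain r where r: "1 - z = of_real r" "r \<le> 0"
      by (auto elim!: nonpos_Reals_cases)
    then have "z = of_real (1 - r)" by (simp add: algebra_simps)
    with r(2) show "z \<in> complex_of_real ` {1..}" by (intro image_eqI[of _ _ "1 - r"]) auto
  next
    assume "z \<in> complex_of_real ` {1..}"
    then show "1 - z \<in> \<real>\<^sub>\<le>\<^sub>0"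
      by (auto simp: complex_nonpos_Reals_iff)
  qed
  then show ?thesis by (simp add: slit_plane_def)
qed

lemma open_slit_plane: "open slit_plane"
proof -
  have "slit_plane = (\<lambda>z. 1 - z) -` (- \<real>\<^sub>\<le>\<^sub>0)"
    by (auto simp: mem_slit_plane)
  moreover have "open ((\<lambda>z::complex. 1 - z) -` (- \<real>\<^sub>\<le>\<^sub>0))"
    by (intro open_vimage continuous_intros open_Compl closed_nonpos_Reals_complex)
  ultimately show ?thesis by simp
qed

lemma starlike_slit_plane: "starlike slit_plane"
  unfolding starlike_def
proof (intro bexI ballI subsetI)
  show "0 \<in> slit_plane" by (simp add: mem_slit_plane)
  fix z w assume z: "z \<in> slit_plane" and w: "w \<in> closed_segment 0 z"
  from w obtain s where s: "0 \<le> s" "s \<le> 1" "w = s *\<^sub>R z"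
    by (auto simp: closed_segment_def)
  show "w \<in> slit_plane"
  proof (rule ccontr)
    assume "w \<notin> slit_plane"
    then obtain r where r: "r \<ge> 1" "w = of_real r"
      by (auto simp: slit_plane_def)
    with s have "s \<noteq> 0" by auto
    with s r have "z = of_real (r / s)"
      by (simp add: scaleR_conv_of_real field_simps)
    moreover have "r / s \<ge> 1" using s r \<open>s \<noteq> 0\<close> by (simp add: field_simps)
    ultimately show False using z
      unfolding slit_plane_def by (metis ComplD atLeast_iff imageI)
  qed
qed

lemma disc_subset_slit_plane: "cball 0 1 - {1} \<subseteq> slit_plane"
proof
  fix z :: complex assume z: "z \<in> cball 0 1 - {1}"
  show "z \<in> slit_plane"
  proof (rule ccontr)
    assume "z \<notin> slit_plane"
    then obtain r where "r \<ge> 1" "z = of_real r"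
      by (auto simp: slit_plane_def)
    with z show False by auto
  qed
qed

lemma ball_subset_slit_plane: "ball 0 1 \<subseteq> slit_plane"
  using disc_subset_slit_plane by force

lemma summable_Li2_bound: "summable (\<lambda>n. 1 / real (Suc n) ^ 2)"
  using inverse_squares_sums by (simp add: sums_iff add.commute)

lemma norm_Li2_term:
  fixes z :: complex
  assumes "norm z \<le> 1"
  shows "norm (z ^ Suc n / of_nat (Suc n) ^ 2) \<le> 1 / real (Suc n) ^ 2"
proof -
  have "norm z ^ Suc n \<le> 1" using assms by (intro power_le_one) auto
  then show ?thesis
    by (simp only: norm_divide norm_power norm_of_nat) (intro divide_right_mono, auto)
qed

lemma Li2_series_sums:
  assumes "norm z \<le> 1"
  shows "(\<lambda>n. z ^ Suc n / of_nat (Suc n) ^ 2) sums Li2_series z"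
  unfolding Li2_series_def
  by (intro summable_sums summable_comparison_test'[OF summable_Li2_bound, of 0])
     (use norm_Li2_term[OF assms] in blast)

lemma continuous_on_Li2_series: "continuous_on (cball 0 1) Li2_series"
proof -
  have "uniform_limit (cball 0 1) (\<lambda>n z. \<Sum>i<n. z ^ Suc i / of_nat (Suc i) ^ 2)
          (\<lambda>z::complex. \<Sum>i. z ^ Suc i / of_nat (Suc i) ^ 2) sequentially"
    by (rule Weierstrass_m_test_ev[OF _ summable_Li2_bound], rule always_eventually)
       (use norm_Li2_term in auto)
  then have "continuous_on (cball 0 1) (\<lambda>z::complex. \<Sum>i. z ^ Suc i / of_nat (Suc i) ^ 2)"
    by (rule uniform_limit_theorem[rotated])
       (auto intro!: always_eventually continuous_intros simp del: power_Suc of_nat_Suc)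
  then show ?thesis by (simp add: Li2_series_def[abs_def])
qed

lemma Li2_series_deriv:
  assumes "norm z < 1"
  shows "(Li2_series has_field_derivative (if z = 0 then 1 else - Ln (1 - z) / z)) (at z)"
proof -
  define c :: "nat \<Rightarrow> complex" where "c n = 1 / of_nat n ^ 2" for n
  have cs: "(\<lambda>n. c n * w ^ n) sums Li2_series w" if "norm w < 1" for w
  proof -
    have "(\<lambda>n. c (Suc n) * w ^ Suc n) sums Li2_series w"
      using Li2_series_sums[of w] that by (simp add: c_def)
    then show ?thesis by (subst (asm) sums_Suc_iff) (simp add: c_def)
  qed
  have "((\<lambda>w. \<Sum>n. c n * w ^ n) has_field_derivative (\<Sum>n. diffs c n * z ^ n)) (at z)"
    by (rule termdiffs_strong'[of 1]) (use cs assms in \<open>auto simp: sums_iff\<close>)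
  then have "(Li2_series has_field_derivative (\<Sum>n. diffs c n * z ^ n)) (at z)"
    by (rule has_field_derivative_transform_within_open[of _ _ _ "ball 0 1"])
       (use cs assms in \<open>auto simp: sums_iff\<close>)
  moreover have dc: "diffs c n = 1 / of_nat (Suc n)" for n
    by (simp add: diffs_def c_def power2_eq_square del: of_nat_Suc)
  moreover have "(\<Sum>n. diffs c n * z ^ n) = (if z = 0 then 1 else - Ln (1 - z) / z)"
  proof (cases "z = 0")
    case True
    then show ?thesis using dc[of 0] by (simp add: powser_zero)
  next
    case False
    have "(\<lambda>n. (- 1) ^ Suc n / of_nat n * (- z) ^ n) sums Ln (1 + (- z))"
      by (rule Ln_series) (use assms in simp)
    then have "(\<lambda>n. - ((- 1) ^ Suc n / of_nat n * (- z) ^ n)) sums - Ln (1 - z)"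
      using sums_minus by force
    moreover have "(\<lambda>n. - ((- 1) ^ Suc n / of_nat n * (- z) ^ n)) = (\<lambda>n. z ^ n / of_nat n)"
    proof
      fix n
      have "(- 1) ^ n * (- z) ^ n = z ^ n"
        by (simp only: power_mult_distrib[symmetric]) simp
      then show "- ((- 1) ^ Suc n / of_nat n * (- z) ^ n) = z ^ n / of_nat n"
        by simp
    qed
    ultimately have "(\<lambda>n. z ^ n / of_nat n) sums - Ln (1 - z)" by metis
    then have "(\<lambda>n. z ^ Suc n / of_nat (Suc n)) sums - Ln (1 - z)"
      by (subst sums_Suc_iff) simp
    from sums_divide[OF this, of z] False
    have "(\<lambda>n. diffs c n * z ^ n) sums (- Ln (1 - z) / z)"
      by (simp add: dc mult.commute)
    then show ?thesis using False by (simp add: sums_iff)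
  qed
  ultimately show ?thesis by simp
qed

lemma Li2_continuation_exists: "\<exists>f. is_Li2_continuation f"
proof -
  define G where "G = (\<lambda>z. if z = 0 then 1 else - Ln (1 - z) / z)"
  have der: "(Li2_series has_field_derivative G z) (at z)" if "norm z < 1" for z
    using Li2_series_deriv[OF that] by (simp add: G_def)
  have "deriv Li2_series holomorphic_on ball 0 1"
    by (intro holomorphic_deriv open_ball) (use der in \<open>force simp: holomorphic_on_open\<close>)
  then have G_ball: "G holomorphic_on ball 0 1"
    by (rule holomorphic_transform) (use der in \<open>auto intro: DERIV_imp_deriv\<close>)
  have "(\<lambda>z. - Ln (1 - z) / z) holomorphic_on slit_plane - {0}"
    by (intro holomorphic_intros) (auto simp: mem_slit_plane)
  then have "G holomorphic_on slit_plane - {0}"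
    by (rule holomorphic_transform) (auto simp: G_def)
  with G_ball have "G holomorphic_on ball 0 1 \<union> (slit_plane - {0})"
    by (intro holomorphic_on_Un) (auto simp: open_slit_plane open_Diff)
  moreover have "ball 0 1 \<union> (slit_plane - {0}) = slit_plane"
    using ball_subset_slit_plane by (auto simp: mem_slit_plane)
  ultimately have G: "G holomorphic_on slit_plane" by simp
  obtain f where f: "\<And>z. z \<in> slit_plane \<Longrightarrow> (f has_field_derivative G z) (at z)"
    using holomorphic_starlike_primitive[OF holomorphic_on_imp_continuous_on[OF G]
        starlike_slit_plane open_slit_plane finite.emptyI]
      holomorphic_on_imp_differentiable_at[OF G open_slit_plane]
    by (metis Diff_iff)
  have "((\<lambda>w. f w - Li2_series w) has_field_derivative 0) (at z within ball 0 1)"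
    if "z \<in> ball 0 1" for z
  proof -
    have "((\<lambda>w. f w - Li2_series w) has_field_derivative (G z - G z)) (at z)"
      by (intro DERIV_diff f der) (use that ball_subset_slit_plane in auto)
    then show ?thesis by (simp add: has_field_derivative_at_within)
  qed
  then obtain c where c: "\<And>z. z \<in> ball 0 1 \<Longrightarrow> f z - Li2_series z = c"
    using has_field_derivative_zero_constant[of "ball (0::complex) 1" "\<lambda>w. f w - Li2_series w"]
    by auto
  have "is_Li2_continuation (\<lambda>z. f z - c)"
    unfolding is_Li2_continuation_def
  proof (intro conjI ballI)
    have "f holomorphic_on slit_plane"
      using f by (auto simp: holomorphic_on_open open_slit_plane)
    then show "(\<lambda>z. f z - c) holomorphic_on slit_plane"
      by (intro holomorphic_intros)
    show "f z - c = Li2_series z" if "z \<in> ball 0 1" for z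
      using c[OF that] by (simp add: algebra_simps)
  qed
  then show ?thesis by blast
qed

lemma Li2_continuation_unique:
  assumes "is_Li2_continuation f" "is_Li2_continuation g" "z \<in> slit_plane"
  shows "f z = g z"
proof -
  have "f z - g z = 0"
  proof (rule analytic_continuation[of "\<lambda>z. f z - g z" slit_plane "ball 0 1" 0])
    show "(\<lambda>z. f z - g z) holomorphic_on slit_plane"
      using assms by (auto simp: is_Li2_continuation_def intro!: holomorphic_intros)
    show "connected slit_plane"
      by (rule starlike_imp_connected[OF starlike_slit_plane])
    show "(0::complex) islimpt ball 0 1" by (simp add: islimpt_ball)
    show "f w - g w = 0" if "w \<in> ball 0 1" for w
      using assms that by (simp add: is_Li2_continuation_def)
  qed (use assms ball_subset_slit_plane open_slit_plane in \<open>auto simp: mem_slit_plane\<close>)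
  then show ?thesis by simp
qed

lemma Li2_eq_continuation:
  assumes "is_Li2_continuation f" "z \<in> slit_plane"
  shows "Li2 z = f z"
proof (cases "norm z \<le> 1")
  case False
  then show ?thesis
    using Li2_continuation_unique[OF _ assms(1,2)] Li2_continuation_exists
    by (simp add: Li2_def someI_ex)
next
  case True
  have holf: "f holomorphic_on slit_plane"
    and f: "\<And>w. w \<in> ball 0 1 \<Longrightarrow> f w = Li2_series w"
    using assms(1) by (auto simp: is_Li2_continuation_def)
  define w where "w n = of_real (1 - inverse (real (Suc n))) * z" for n
  have "w \<longlonglongrightarrow> of_real (1 - 0) * z"
    unfolding w_def by (intro tendsto_intros LIMSEQ_inverse_real_of_nat)
  then have lim: "w \<longlonglongrightarrow> z" by simp
  have ball: "w n \<in> ball 0 1" for n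
  proof -
    have a: "0 \<le> 1 - inverse (real (Suc n))" "1 - inverse (real (Suc n)) < 1"
      by (auto simp: field_simps)
    have "norm (w n) = (1 - inverse (real (Suc n))) * norm z"
      using a(1) by (simp only: w_def norm_mult norm_of_real abs_of_nonneg)
    also have "\<dots> \<le> (1 - inverse (real (Suc n))) * 1"
      by (rule mult_left_mono[OF True a(1)])
    finally have "norm (w n) < 1" using a(2) by (simp only: mult_1_right)
    then show ?thesis by simp
  qed
  then have "w n \<in> cball 0 1" "w n \<in> slit_plane" for n
    using ball[of n] ball_subset_slit_plane by (auto intro: less_imp_le)
  then have "(\<lambda>n. Li2_series (w n)) \<longlonglongrightarrow> Li2_series z" "(\<lambda>n. f (w n)) \<longlonglongrightarrow> f z"
    using True assms(2) lim
    by (auto intro!: always_eventually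
        continuous_on_tendsto_compose[OF continuous_on_Li2_series]
        continuous_on_tendsto_compose[OF holomorphic_on_imp_continuous_on[OF holf]])
  moreover have "(\<lambda>n. f (w n)) = (\<lambda>n. Li2_series (w n))" using f[OF ball] by simp
  ultimately have "Li2_series z = f z"
    using LIMSEQ_unique by metis
  with True show ?thesis by (simp add: Li2_def)
qed

lemma Li2_sums: "norm z \<le> 1 \<Longrightarrow> (\<lambda>n. z ^ Suc n / of_nat (Suc n) ^ 2) sums Li2 z"
  using Li2_series_sums by (simp add: Li2_def)

lemma Li2_holomorphic: "Li2 holomorphic_on slit_plane"
proof -
  obtain f where f: "is_Li2_continuation f" using Li2_continuation_exists by blast
  then have "f holomorphic_on slit_plane" by (simp add: is_Li2_continuation_def)
  then show ?thesis
    by (rule holomorphic_transform) (use Li2_eq_continuation[OF f] in auto)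
qed

lemma Li2_1: "Li2 1 = of_real (pi\<^sup>2 / 6)"
proof -
  have "(\<lambda>n. complex_of_real (1 / (real n + 1)\<^sup>2)) sums of_real (pi\<^sup>2 / 6)"
    using inverse_squares_sums by (intro sums_of_real) (simp add: add.commute)
  moreover have "(\<lambda>n. 1 ^ Suc n / of_nat (Suc n) ^ 2) sums Li2 1" by (rule Li2_sums) simp
  ultimately show ?thesis by (simp add: sums_iff add.commute)
qed

end

theory Submission
  imports Defs
begin

text \<open>
  Put \<open>s = t\<^sup>1\<^sup>/\<^sup>q\<close>, so that \<open>u t\<^sup>p\<^sup>/\<^sup>q = (a s)\<^sup>p\<close> and \<open>v t = (b s)\<^sup>q\<close>. The factorisations
  of \<open>1 - X\<^sup>p\<close> and \<open>1 - X\<^sup>q\<close> over the roots of unity split the logarithm into the sum of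
  \<open>Ln (1 - \<alpha> a s)\<close> over \<open>\<alpha>\<close>, and the kernel \<open>1 / (1/v - t)\<close>, through the logarithmic derivative
  of \<open>1 - v s\<^sup>q\<close>, into a sum over \<open>\<beta>\<close>. The integral becomes the double sum over
  \<open>A = \<alpha> a\<close> and \<open>w = \<beta> b\<close> of the integrals over \<open>[0, 1]\<close> of \<open>w Ln (1 - A s) / (1 - w s)\<close> in \<open>s\<close>.

  For a single pair this integrand has the explicit primitive
  \<open>Li2 (A s) + Li2 (w s / (w s - 1)) - Li2 ((A - w) s / (1 - w s))\<close>, which is \<open>dilog_primitive\<close>:
  each argument \<open>g\<close> satisfies \<open>Li2' (g) g = - Ln (1 - g)\<close>, and \<open>1 - g\<close> is \<open>1 - A s\<close>, the
  reciprocal of \<open>1 - w s\<close>, or the quotient of the two. Both numbers lie in the right half-plane,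
  so all logarithms are principal and expand without multiples of \<open>2 \<pi> \<i>\<close>
  (\<open>dilog_primitive_deriv\<close>). The primitive vanishes at 0 and is continuous up to \<open>s = 1\<close>
  (\<open>continuous_on_dilog_primitive\<close>), even when \<open>A = 1\<close> and the branch point is reached. At
  \<open>s = 1\<close> its last two terms are those of the formula; the first, \<open>Li2 (\<alpha> a)\<close>, summed over
  \<open>\<alpha>\<close> and counted once for each \<open>\<beta>\<close>, gives \<open>(q / p) Li2 u\<close> by the distribution relation
  \<open>sum_Li2_roots_of_unity\<close>.

  The two splittings and the distribution relation are the same statement about three power
  series: averaging over the roots of unity keeps the exponents divisible by \<open>p\<close>
  (\<open>sums_over_roots_of_unity\<close>). Working with power series also removes any question of branches
  in splitting the logarithm.
\<close>

section \<open>Root-of-unity filter for power series\<close>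

lemma sum_powers_roots_of_unity:
  assumes "p > 0"
  shows "(\<Sum>\<alpha>::complex | \<alpha> ^ p = 1. \<alpha> ^ n) = (if p dvd n then of_nat p else 0)"
proof (cases "p dvd n")
  case True
  then obtain k where n: "n = p * k" by blast
  have "(\<Sum>\<alpha>::complex | \<alpha> ^ p = 1. \<alpha> ^ n) = (\<Sum>\<alpha>::complex | \<alpha> ^ p = 1. 1)"
    by (intro sum.cong) (auto simp: n power_mult)
  then show ?thesis using True assms by (simp add: card_roots_unity_eq)
next
  case False
  define e where "e k = cis (2 * pi * real k / real p)" for k :: nat
  have bij: "bij_betw e {..<p} {z. z ^ p = 1}"
    unfolding e_def by (rule Complex.bij_betw_roots_unity[OF assms])
  have e: "e 1 ^ k = e k" for k
    by (simp add: e_def Complex.DeMoivre mult_ac)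
  have root: "e 1 ^ p = 1"
    by (simp add: e_def Complex.DeMoivre assms)
  have "e (n mod p) \<noteq> e 0"
    using inj_onD[OF bij_betw_imp_inj_on[OF bij], of "n mod p" 0] assms False
    by (auto simp: mod_eq_0_iff_dvd)
  moreover have "e 1 ^ n = e (n mod p)"
  proof -
    have "e 1 ^ n = e 1 ^ (p * (n div p) + n mod p)" by simp
    also have "\<dots> = e 1 ^ (n mod p)" by (simp only: power_add power_mult root) simp
    finally show ?thesis by (simp only: e)
  qed
  ultimately have ne: "e 1 ^ n \<noteq> 1" by (simp add: e_def)
  \<comment> \<open>Multiplication by a primitive root permutes the roots and scales the sum by a factor
      different from 1.\<close>
  have e0: "e 1 \<noteq> 0" by (simp add: e_def)
  have "(\<Sum>\<alpha>::complex | \<alpha> ^ p = 1. \<alpha> ^ n) = (\<Sum>\<alpha> | \<alpha> ^ p = 1. (e 1 * \<alpha>) ^ n)"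
    by (rule sum.reindex_bij_witness[of _ "\<lambda>x. e 1 * x" "\<lambda>x. x / e 1"])
       (use e0 root in \<open>auto simp: power_mult_distrib power_divide\<close>)
  also have "\<dots> = e 1 ^ n * (\<Sum>\<alpha> | \<alpha> ^ p = 1. \<alpha> ^ n)"
    by (simp add: power_mult_distrib sum_distrib_left)
  finally have "(1 - e 1 ^ n) * (\<Sum>\<alpha>::complex | \<alpha> ^ p = 1. \<alpha> ^ n) = 0"
    by (simp add: algebra_simps)
  then show ?thesis using ne False by simp
qed

text \<open>
  Summing over \<open>\<alpha>\<close> inside the series multiplies the coefficient of \<open>z ^ n\<close> by the power sum
  above, so only the indices \<open>n = k * p\<close> survive.
\<close>

lemma sums_over_roots_of_unity:
  fixes c :: "nat \<Rightarrow> complex"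
  assumes "p > 0"
    and sums: "\<And>\<alpha>. \<alpha> ^ p = 1 \<Longrightarrow> (\<lambda>n. c n * (\<alpha> * z) ^ n) sums f (\<alpha> * z)"
  shows "(\<lambda>k. of_nat p * c (k * p) * (z ^ p) ^ k) sums (\<Sum>\<alpha> | \<alpha> ^ p = 1. f (\<alpha> * z))"
proof -
  have "(\<lambda>n. \<Sum>\<alpha> | \<alpha> ^ p = 1. c n * (\<alpha> * z) ^ n) sums (\<Sum>\<alpha> | \<alpha> ^ p = 1. f (\<alpha> * z))"
    by (intro sums_sum sums) auto
  moreover have "(\<Sum>\<alpha> | \<alpha> ^ p = 1. c n * (\<alpha> * z) ^ n) =
      c n * z ^ n * (if p dvd n then of_nat p else 0)" for n
    by (subst sum_powers_roots_of_unity[OF assms(1), symmetric])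
       (simp add: sum_distrib_left power_mult_distrib mult_ac)
  ultimately have "(\<lambda>n. c n * z ^ n * (if p dvd n then of_nat p else 0)) sums
      (\<Sum>\<alpha> | \<alpha> ^ p = 1. f (\<alpha> * z))" by simp
  then have "(\<lambda>k. c (k * p) * z ^ (k * p) * (if p dvd k * p then of_nat p else 0)) sums
      (\<Sum>\<alpha> | \<alpha> ^ p = 1. f (\<alpha> * z))"
    by (subst sums_mono_reindex) (use assms(1) in \<open>auto simp: strict_mono_def elim: dvdE\<close>)
  then show ?thesis by (simp add: mult_ac power_mult[symmetric])
qed

lemma norm_root_of_unity_mult:
  fixes \<alpha> :: complex
  assumes "p > 0" "\<alpha> ^ p = 1"
  shows "norm (\<alpha> * z) = norm z"
  using assms power_eq_1_iff[of \<alpha> p] by (auto simp: norm_mult)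

text \<open>
  Up to sign this is the logarithmic derivative, times \<open>z\<close>, of the product of the factors
  \<open>1 - \<beta> z\<close>; here it is the filter applied to the geometric series.
\<close>

lemma sum_geometric_roots_of_unity:
  fixes z :: complex
  assumes "q > 0" "norm z < 1"
  shows "(\<Sum>\<beta> | \<beta> ^ q = 1. \<beta> * z / (1 - \<beta> * z)) = of_nat q * z ^ q / (1 - z ^ q)"
proof -
  have lt: "norm (\<beta> * z) < 1" if "\<beta> ^ q = 1" for \<beta>
    using norm_root_of_unity_mult[OF assms(1) that] assms(2) by simp
  have zq: "norm (z ^ q) < 1"
    using assms by (simp add: norm_power power_less_one_iff)
  then have nz: "z ^ q \<noteq> 1" by auto
  have "(\<lambda>n. 1 * (\<beta> * z) ^ n) sums (1 / (1 - \<beta> * z))" if "\<beta> ^ q = 1" for \<beta>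
    using geometric_sums[OF lt[OF that]] by simp
  from sums_over_roots_of_unity[where f = "\<lambda>w. 1 / (1 - w)", OF assms(1) this]
  have "(\<lambda>k. of_nat q * (z ^ q) ^ k) sums (\<Sum>\<beta> | \<beta> ^ q = 1. 1 / (1 - \<beta> * z))" by simp
  moreover have "(\<lambda>k. of_nat q * (z ^ q) ^ k) sums (of_nat q * (1 / (1 - z ^ q)))"
    by (intro sums_mult geometric_sums zq)
  ultimately have *: "(\<Sum>\<beta> | \<beta> ^ q = 1. 1 / (1 - \<beta> * z)) = of_nat q * (1 / (1 - z ^ q))"
    by (rule sums_unique2)
  have "(\<Sum>\<beta> | \<beta> ^ q = 1. \<beta> * z / (1 - \<beta> * z)) = (\<Sum>\<beta> | \<beta> ^ q = 1. 1 / (1 - \<beta> * z) - 1)"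
  proof (intro sum.cong refl)
    fix \<beta> assume "\<beta> \<in> {\<beta>::complex. \<beta> ^ q = 1}"
    then have "1 - \<beta> * z \<noteq> 0" using lt[of \<beta>] by auto
    then show "\<beta> * z / (1 - \<beta> * z) = 1 / (1 - \<beta> * z) - 1" by (simp add: divide_simps)
  qed
  also have "\<dots> = of_nat q * (1 / (1 - z ^ q)) - of_nat q"
    using assms(1) by (simp add: sum_subtractf * card_roots_unity_eq)
  also have "\<dots> = of_nat q * z ^ q / (1 - z ^ q)"
    using nz by (simp add: field_simps)
  finally show ?thesis .
qed

text \<open>
  Inside the unit disc the principal logarithm is its power series, so comparing coefficients
  gives equality on the nose and not only modulo \<open>2 \<pi> \<i>\<close>.
\<close>

lemma sum_Ln_roots_of_unity:
  assumes "p > 0" "norm z < 1"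
  shows "(\<Sum>\<alpha> | \<alpha> ^ p = 1. Ln (1 - \<alpha> * z)) = Ln (1 - z ^ p)"
proof -
  have Ln_sums: "(\<lambda>n. - (1 / of_nat n) * w ^ n) sums Ln (1 - w)" if "norm w < 1" for w
    using Ln_series'[of "- w"] that by simp
  have lt: "norm (\<alpha> * z) < 1" if "\<alpha> ^ p = 1" for \<alpha>
    using norm_root_of_unity_mult[OF assms(1) that] assms(2) by simp
  have zp: "norm (z ^ p) < 1"
    using assms by (simp add: norm_power power_less_one_iff)
  have "(\<lambda>k. of_nat p * - (1 / of_nat (k * p)) * (z ^ p) ^ k) sums
      (\<Sum>\<alpha> | \<alpha> ^ p = 1. Ln (1 - \<alpha> * z))"
    by (rule sums_over_roots_of_unity[where f = "\<lambda>w. Ln (1 - w)", OF assms(1) Ln_sums])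
       (rule lt)
  also have "(\<lambda>k. of_nat p * - (1 / of_nat (k * p)) * (z ^ p) ^ k) =
      (\<lambda>k. - (1 / of_nat k) * (z ^ p) ^ k)"
    using assms(1) by (auto simp: fun_eq_iff field_simps)
  finally show ?thesis
    using Ln_sums[OF zp] by (rule sums_unique2)
qed

text \<open>
  The distribution relation of the dilogarithm: the filter turns the coefficient \<open>1 / n\<^sup>2\<close> into
  \<open>p / (k p)\<^sup>2 = 1 / (p k\<^sup>2)\<close>. It holds on the closed disc because the series converges there.
\<close>

lemma sum_Li2_roots_of_unity:
  assumes "p > 0" "norm z \<le> 1"
  shows "(\<Sum>\<alpha> | \<alpha> ^ p = 1. Li2 (\<alpha> * z)) = Li2 (z ^ p) / of_nat p"
proof -
  \<comment> \<open>The term of index 0 is \<open>1 / 0 = 0\<close>, so the series may start there.\<close>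
  have Li2_powser: "(\<lambda>n. 1 / of_nat n ^ 2 * w ^ n) sums Li2 w" if "norm w \<le> 1" for w
  proof -
    have "(\<lambda>n. 1 / of_nat (Suc n) ^ 2 * w ^ Suc n) sums Li2 w"
      using Li2_sums[OF that] by simp
    then show ?thesis by (subst (asm) sums_Suc_iff) simp
  qed
  have le: "norm (\<alpha> * z) \<le> 1" if "\<alpha> ^ p = 1" for \<alpha>
    using norm_root_of_unity_mult[OF assms(1) that] assms(2) by simp
  have zp: "norm (z ^ p) \<le> 1"
    using assms by (simp add: norm_power power_le_one)
  have "(\<lambda>k. of_nat p * (1 / of_nat (k * p) ^ 2) * (z ^ p) ^ k) sums
      (\<Sum>\<alpha> | \<alpha> ^ p = 1. Li2 (\<alpha> * z))"
    by (rule sums_over_roots_of_unity[OF assms(1) Li2_powser]) (rule le)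
  also have "(\<lambda>k. of_nat p * (1 / of_nat (k * p) ^ 2) * (z ^ p) ^ k) =
      (\<lambda>k. (1 / of_nat k ^ 2 * (z ^ p) ^ k) / of_nat p)"
    using assms(1) by (auto simp: fun_eq_iff field_simps power2_eq_square)
  finally show ?thesis
    using sums_divide[OF Li2_powser[OF zp]] by (rule sums_unique2)
qed

section \<open>Logarithms and slit-plane membership in the right half-plane\<close>

text \<open>
  The closed unit disc touches the line of real part 1 only at 1. This keeps
  the dilogarithm arguments below off the cut, except for the branch point reached when \<open>A = 1\<close>
  and \<open>s = 1\<close>.
\<close>

lemma Re_one_minus_pos:
  assumes "norm z \<le> 1" "z \<noteq> 1"
  shows "Re (1 - z) > 0"
proof (rule ccontr)
  assume "\<not> Re (1 - z) > 0"
  with complex_Re_le_cmod[of z] assms(1) have re: "Re z = 1" by simp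
  have "(Re z)\<^sup>2 + (Im z)\<^sup>2 \<le> 1\<^sup>2"
    unfolding cmod_power2[symmetric] by (rule power_mono) (use assms in auto)
  with re have "Im z = 0" by simp
  with re assms(2) show False by (simp add: complex_eq_iff)
qed

lemma divide_right_half_plane:
  assumes "Re x > 0" "Re y > 0"
  shows "x / y \<notin> \<real>\<^sub>\<le>\<^sub>0"
proof
  assume "x / y \<in> \<real>\<^sub>\<le>\<^sub>0"
  then obtain r where r: "x / y = of_real r" "r \<le> 0"
    by (auto elim!: nonpos_Reals_cases)
  have "y \<noteq> 0" using assms by auto
  with r have "x = of_real r * y" by (simp add: field_simps)
  then have "Re x = r * Re y" by simp
  with assms r(2) show False by (simp add: mult_le_0_iff zero_less_mult_iff)
qed

text \<open>
  In the right half-plane arguments are below \<open>\<pi> / 2\<close> in absolute value, so their difference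
  stays within the principal range.
\<close>

lemma Ln_divide_right_half_plane:
  assumes "Re x > 0" "Re y > 0"
  shows "Ln (x / y) = Ln x - Ln y"
proof -
  have nz: "x \<noteq> 0" "y \<noteq> 0" using assms by auto
  then have "\<bar>Im (Ln x)\<bar> < pi / 2" "\<bar>Im (Ln y)\<bar> < pi / 2"
    using Re_Ln_pos_lt assms by blast+
  then have "Ln (exp (Ln x - Ln y)) = Ln x - Ln y"
    by (intro Ln_exp) auto
  then show ?thesis using nz by (simp add: exp_diff)
qed

section \<open>Derivative of the dilogarithm\<close>

text \<open>
  The multiplied-out form \<open>D * z = - Ln (1 - z)\<close> avoids the removable singularity at 0. Both sides
  are holomorphic on the slit plane and agree on the disc of convergence.
\<close>

lemma Li2_deriv:
  assumes "z \<in> slit_plane"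
  obtains D where "(Li2 has_field_derivative D) (at z)" "D * z = - Ln (1 - z)"
proof
  show "(Li2 has_field_derivative deriv Li2 z) (at z)"
    by (rule holomorphic_derivI[OF Li2_holomorphic open_slit_plane assms])
  have "deriv Li2 z * z + Ln (1 - z) = 0"
  proof (rule analytic_continuation[of "\<lambda>z. deriv Li2 z * z + Ln (1 - z)" slit_plane "ball 0 1" 0])
    show "(\<lambda>z. deriv Li2 z * z + Ln (1 - z)) holomorphic_on slit_plane"
      by (intro holomorphic_intros Li2_holomorphic open_slit_plane) (auto simp: mem_slit_plane)
    show "connected slit_plane"
      by (rule starlike_imp_connected[OF starlike_slit_plane])
    show "(0::complex) islimpt ball 0 1" by (simp add: islimpt_ball)
    show "deriv Li2 w * w + Ln (1 - w) = 0" if w: "w \<in> ball 0 1" for w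
    proof -
      have "(Li2 has_field_derivative (if w = 0 then 1 else - Ln (1 - w) / w)) (at w)"
        by (rule has_field_derivative_transform_within_open[OF Li2_series_deriv open_ball w])
           (use w in \<open>auto simp: Li2_def\<close>)
      then have "deriv Li2 w = (if w = 0 then 1 else - Ln (1 - w) / w)"
        by (rule DERIV_imp_deriv)
      then show ?thesis by auto
    qed
  qed (use assms ball_subset_slit_plane open_slit_plane in \<open>auto simp: mem_slit_plane\<close>)
  then show "deriv Li2 z * z = - Ln (1 - z)" by (simp add: add_eq_0_iff)
qed

text \<open>
  Prescribing the derivative of \<open>g\<close> as \<open>g z * h\<close>, with \<open>h\<close> its logarithmic derivative where
  \<open>g z\<close> is nonzero, lets the result hold also where \<open>g z = 0\<close>. This covers the case \<open>A = w\<close>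
  below, in which one argument vanishes identically.
\<close>

lemma Li2_compose_deriv:
  assumes "g z \<in> slit_plane" "(g has_field_derivative g z * h) (at z)"
  shows "((\<lambda>z. Li2 (g z)) has_field_derivative - Ln (1 - g z) * h) (at z)"
proof -
  obtain D where D: "(Li2 has_field_derivative D) (at (g z))" "D * g z = - Ln (1 - g z)"
    using Li2_deriv[OF assms(1)] .
  have "((\<lambda>z. Li2 (g z)) has_field_derivative D * (g z * h)) (at z)"
    using DERIV_chain2[OF D(1) assms(2)] .
  then show ?thesis by (simp only: mult.assoc[symmetric] D(2))
qed

lemma continuous_on_Li2_cball: "continuous_on (cball 0 1) Li2"
  by (rule continuous_on_eq[OF continuous_on_Li2_series]) (simp add: Li2_def)

lemma continuous_on_Li2_slit_plane: "continuous_on slit_plane Li2"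
  by (rule holomorphic_on_imp_continuous_on[OF Li2_holomorphic])

section \<open>The primitive for one pair of roots\<close>

definition dilog_primitive :: "complex \<Rightarrow> complex \<Rightarrow> complex \<Rightarrow> complex" where
  "dilog_primitive A w s =
     Li2 (A * s) + Li2 (w * s / (w * s - 1)) - Li2 ((A - w) * s / (1 - w * s))"

lemma dilog_primitive_0: "dilog_primitive A w 0 = 0"
proof -
  have "Li2 0 = 0" by (simp add: Li2_def Li2_series_def)
  then show ?thesis by (simp add: dilog_primitive_def)
qed

lemma one_minus_arguments:
  fixes A w s :: complex
  assumes "w * s \<noteq> 1"
  shows "1 - w * s / (w * s - 1) = 1 / (1 - w * s)"
    and "1 - (A - w) * s / (1 - w * s) = (1 - A * s) / (1 - w * s)"
  using assms by (auto simp: divide_simps) (auto simp: algebra_simps)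

text \<open>
  The arguments have logarithmic derivatives \<open>1 / s\<close>, \<open>1 / (s (1 - w s))\<close> and
  \<open>1 / (s (1 - w s))\<close>. The contributions of \<open>Ln (1 - w s)\<close> from the second and the third cancel,
  and \<open>Ln (1 - A s)\<close> is left with the factor \<open>1 / (s (1 - w s)) - 1 / s = w / (1 - w s)\<close>.
\<close>

lemma dilog_primitive_deriv:
  assumes "s \<noteq> 0" "norm (A * s) < 1" "norm (w * s) < 1"
  shows "(dilog_primitive A w has_field_derivative Ln (1 - A * s) * (w / (1 - w * s))) (at s)"
proof -
  have re: "Re (1 - A * s) > 0" "Re (1 - w * s) > 0"
    using assms by (auto intro!: Re_one_minus_pos simp del: minus_complex.sel)
  have ne: "w * s \<noteq> 1" using assms by auto
  then have ne': "1 - w * s \<noteq> 0" "w * s - 1 \<noteq> 0" by auto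
  note om = one_minus_arguments[OF ne]
  have 1: "((\<lambda>s. Li2 (A * s)) has_field_derivative - Ln (1 - A * s) * (1 / s)) (at s)"
  proof (rule Li2_compose_deriv)
    show "A * s \<in> slit_plane" using ball_subset_slit_plane assms by auto
    show "((\<lambda>s. A * s) has_field_derivative A * s * (1 / s)) (at s)"
      using assms(1) by (auto intro!: derivative_eq_intros)
  qed
  have 2: "((\<lambda>s. Li2 (w * s / (w * s - 1))) has_field_derivative
      - Ln (1 - w * s / (w * s - 1)) * (1 / (s * (1 - w * s)))) (at s)"
  proof (rule Li2_compose_deriv)
    show "w * s / (w * s - 1) \<in> slit_plane"
      using divide_right_half_plane[of 1, OF _ re(2)] by (simp add: mem_slit_plane om)
    have "(w * (w * s - 1) - w * s * w) / ((w * s - 1) * (w * s - 1)) =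
        w * s / (w * s - 1) * (1 / (s * (1 - w * s)))"
      using assms(1) ne' by (simp add: divide_simps) (simp add: algebra_simps)
    moreover have "((\<lambda>s. w * s / (w * s - 1)) has_field_derivative
        (w * (w * s - 1) - w * s * w) / ((w * s - 1) * (w * s - 1))) (at s)"
      using ne' by (auto intro!: derivative_eq_intros)
    ultimately show "((\<lambda>s. w * s / (w * s - 1)) has_field_derivative
        w * s / (w * s - 1) * (1 / (s * (1 - w * s)))) (at s)" by simp
  qed
  have 3: "((\<lambda>s. Li2 ((A - w) * s / (1 - w * s))) has_field_derivative
      - Ln (1 - (A - w) * s / (1 - w * s)) * (1 / (s * (1 - w * s)))) (at s)"
  proof (rule Li2_compose_deriv)
    show "(A - w) * s / (1 - w * s) \<in> slit_plane"
      using divide_right_half_plane[OF re] by (simp add: mem_slit_plane om)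
    have "((A - w) * (1 - w * s) - (A - w) * s * (- w)) / ((1 - w * s) * (1 - w * s)) =
        (A - w) * s / (1 - w * s) * (1 / (s * (1 - w * s)))"
      using assms(1) ne' by (simp add: divide_simps) (simp add: algebra_simps)
    moreover have "((\<lambda>s. (A - w) * s / (1 - w * s)) has_field_derivative
        ((A - w) * (1 - w * s) - (A - w) * s * (- w)) / ((1 - w * s) * (1 - w * s))) (at s)"
      using ne' by (auto intro!: derivative_eq_intros)
    ultimately show "((\<lambda>s. (A - w) * s / (1 - w * s)) has_field_derivative
        (A - w) * s / (1 - w * s) * (1 / (s * (1 - w * s)))) (at s)" by simp
  qed
  have L2: "Ln (1 - w * s / (w * s - 1)) = - Ln (1 - w * s)"
    using Ln_divide_right_half_plane[of 1, OF _ re(2)] by (simp add: om)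
  have L3: "Ln (1 - (A - w) * s / (1 - w * s)) = Ln (1 - A * s) - Ln (1 - w * s)"
    using Ln_divide_right_half_plane[OF re] by (simp add: om)
  have alg: "- X * (1 / s) + - (- Y) * (1 / (s * (1 - w * s))) - - (X - Y) * (1 / (s * (1 - w * s)))
      = X * (w / (1 - w * s))" for X Y :: complex
    using assms(1) ne' by (simp add: divide_simps) (simp add: algebra_simps)
  show ?thesis
    unfolding dilog_primitive_def[abs_def]
    using DERIV_diff[OF DERIV_add[OF 1 2] 3] by (simp only: L2 L3 alg)
qed

text \<open>
  For \<open>A = 1\<close> the third argument of the primitive tends to the branch point 1, where the
  principal branch is known to be continuous from within the closed disc. This bound shows that
  the whole path stays in that disc.
\<close>

lemma norm_mobius_le_1:
  fixes w :: complex
  assumes "norm w \<le> 1" "w \<noteq> 1" "0 \<le> s" "s \<le> 1"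
  shows "norm ((1 - w) * of_real s / (1 - w * of_real s)) \<le> 1"
proof -
  have "Re w \<le> 1" using complex_Re_le_cmod[of w] assms(1) by linarith
  then have "0 \<le> (1 - s) * ((1 - s) + 2 * s * (1 - Re w))"
    using assms by (intro mult_nonneg_nonneg add_nonneg_nonneg) auto
  also have "\<dots> = (norm (1 - w * of_real s))\<^sup>2 - (norm ((1 - w) * of_real s))\<^sup>2"
    unfolding cmod_power2 by (simp, algebra)
  finally have "(norm ((1 - w) * of_real s))\<^sup>2 \<le> (norm (1 - w * of_real s))\<^sup>2"
    by (simp only: diff_ge_0_iff_ge)
  then have "norm ((1 - w) * of_real s) \<le> norm (1 - w * of_real s)"
    by (rule power2_le_imp_le) (rule norm_ge_zero)
  then show ?thesis by (simp add: norm_divide divide_le_eq_1)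
qed

text \<open>
  Continuity up to \<open>s = 1\<close> is what allows \<open>A\<close> and \<open>w\<close> on the unit circle, where the
  primitive need not be differentiable at the endpoint.
\<close>

lemma continuous_on_dilog_primitive:
  assumes "norm A \<le> 1" "norm w \<le> 1" "w \<noteq> 1"
  shows "continuous_on {0..1} (\<lambda>s. dilog_primitive A w (of_real s))"
proof -
  have le: "norm (z * of_real s) \<le> 1" if "norm z \<le> 1" "s \<in> {0..1}" for z :: complex and s
    using that by (auto simp: norm_mult intro!: mult_le_one)
  have ne: "z * of_real s \<noteq> 1" if "norm z \<le> 1" "z \<noteq> 1" "s \<in> {0..1}" for z :: complex and s
  proof
    assume eq: "z * of_real s = 1"
    then have "norm z * s = 1" using that(3)
      by (metis abs_of_nonneg atLeastAtMost_iff norm_mult norm_of_real norm_one)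
    moreover have "norm z * s \<le> 1 * s" using that by (intro mult_right_mono) auto
    ultimately have "s = 1" using that(3) by simp
    with eq that(2) show False by simp
  qed
  have re: "Re (1 - z * of_real s) > 0" if "norm z \<le> 1" "z \<noteq> 1" "s \<in> {0..1}" for z s
    by (rule Re_one_minus_pos[OF le ne]) (use that in auto)
  note wne = ne[OF assms(2,3)]
  note om = one_minus_arguments[OF wne]
  have 1: "continuous_on {0..1} (\<lambda>s. Li2 (A * of_real s))"
    by (rule continuous_on_compose2[OF continuous_on_Li2_cball])
       (use le[OF assms(1)] in \<open>auto intro!: continuous_intros\<close>)
  have 2: "continuous_on {0..1} (\<lambda>s. Li2 (w * of_real s / (w * of_real s - 1)))"
  proof (rule continuous_on_compose2[OF continuous_on_Li2_slit_plane])
    show "continuous_on {0..1} (\<lambda>s. w * of_real s / (w * of_real s - 1))"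
      using wne by (intro continuous_intros) auto
    show "(\<lambda>s. w * of_real s / (w * of_real s - 1)) ` {0..1} \<subseteq> slit_plane"
      using divide_right_half_plane[of 1, OF _ re[OF assms(2,3)]]
      by (auto simp: mem_slit_plane om)
  qed
  have cont: "continuous_on {0..1} (\<lambda>s. (A - w) * of_real s / (1 - w * of_real s))"
    using wne by (intro continuous_intros) auto
  have 3: "continuous_on {0..1} (\<lambda>s. Li2 ((A - w) * of_real s / (1 - w * of_real s)))"
  proof (cases "A = 1")
    \<comment> \<open>For \<open>A = 1\<close> the argument reaches the branch point 1 at \<open>s = 1\<close>, but only from within the
        closed disc.\<close>
    case True
    show ?thesis
      by (rule continuous_on_compose2[OF continuous_on_Li2_cball cont])
         (use norm_mobius_le_1[OF assms(2,3)] True in auto)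
  next
    case False
    show ?thesis
      by (rule continuous_on_compose2[OF continuous_on_Li2_slit_plane cont])
         (use divide_right_half_plane[OF re[OF assms(1) False] re[OF assms(2,3)]] in
           \<open>auto simp: mem_slit_plane om\<close>)
  qed
  show ?thesis
    unfolding dilog_primitive_def by (intro continuous_intros 1 2 3)
qed

section \<open>Evaluation of the integral\<close>

theorem theorem2p5:
  fixes u v a b :: complex and p q :: nat
  assumes "u \<in> punctured_disc"
    and "v \<in> punctured_disc - {1}"
    and "p > 0" and "q > 0"
    and "a ^ p = u" and "b ^ q = v"
  shows "scriptF (of_nat p / of_nat q) u v =
           of_nat q / of_nat p * Li2 u +
           (\<Sum>\<alpha> | \<alpha> ^ p = 1. \<Sum>\<beta> | \<beta> ^ q = 1.
              Li2 (\<beta> * b / (\<beta> * b - 1)) - Li2 ((\<alpha> * a - \<beta> * b) / (1 - \<beta> * b)))"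
proof -
  \<comment> \<open>Composing the primitives with \<open>t\<close> to the power \<open>1 / q\<close> gives a primitive in the original
      variable, so the integral itself needs no substitution.\<close>
  define r where "r t = t powr (1 / real q)" for t :: real
  define M where "M t = (\<Sum>\<alpha> | \<alpha> ^ p = 1. \<Sum>\<beta> | \<beta> ^ q = 1.
      dilog_primitive (\<alpha> * a) (\<beta> * b) (of_real (r t)))" for t
  define f where "f t = Ln (1 - u * of_real t powr (of_nat p / of_nat q)) / (inverse v - of_real t)"
    for t :: real
  have "norm u \<le> 1" "norm v \<le> 1"
    using assms(1,2) by (simp_all add: punctured_disc_def)
  then have "norm a ^ p \<le> 1" "norm b ^ q \<le> 1"
    by (simp_all only: assms(5,6)[symmetric] norm_power)
  then have norm_a: "norm a \<le> 1" and norm_b: "norm b \<le> 1"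
    using assms(3,4) by (simp_all add: power_le_one_iff)
  have A: "norm (\<alpha> * a) \<le> 1" if "\<alpha> ^ p = 1" for \<alpha>
    using norm_root_of_unity_mult[OF assms(3) that] norm_a by simp
  have w: "norm (\<beta> * b) \<le> 1" "\<beta> * b \<noteq> 1" if "\<beta> ^ q = 1" for \<beta>
  proof -
    show "norm (\<beta> * b) \<le> 1"
      using norm_root_of_unity_mult[OF assms(4) that] norm_b by simp
    have "(\<beta> * b) ^ q = v" using that assms(6) by (simp add: power_mult_distrib)
    then show "\<beta> * b \<noteq> 1" using assms(2) by auto
  qed
  have "v \<noteq> 0" using assms(2) by (simp add: punctured_disc_def)

  have "(f has_integral M 1 - M 0) {0..1}"
  proof (rule fundamental_theorem_of_calculus_interior)
    have r_cont: "continuous_on {0..1} r"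
      unfolding r_def using assms(4) by (intro continuous_on_powr' continuous_intros) auto
    have r_range: "r ` {0..1} \<subseteq> {0..1}"
      by (auto simp: r_def powr_le1)
    have "continuous_on {0..1} (\<lambda>t. dilog_primitive (\<alpha> * a) (\<beta> * b) (of_real (r t)))"
      if "\<alpha> ^ p = 1" "\<beta> ^ q = 1" for \<alpha> \<beta>
      by (rule continuous_on_compose2[OF continuous_on_dilog_primitive r_cont r_range])
         (use A w that in auto)
    then show "continuous_on {0..1} M"
      unfolding M_def by (intro continuous_on_sum) auto
    show "(M has_vector_derivative f t) (at t)" if t: "t \<in> {0<..<1}" for t
    proof -
      define s where "s = r t"
      have s: "0 < s" "s < 1" 
        using t assms(4) powr_less_mono2[of "1 / real q" t 1] by (auto simp: s_def r_def)
      have s_pow: "s ^ n = t powr (real n / real q)" for n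
        using t by (simp add: s_def r_def powr_power)
      have s_q: "s ^ q = t"
        using t assms(4) by (simp add: s_pow)
      have s_p: "complex_of_real t powr (of_nat p / of_nat q) = of_real s ^ p"
      proof -
        have "complex_of_real t powr (of_real (real p / real q)) = of_real (t powr (real p / real q))"
          using t by (intro powr_of_real) auto
        also have "t powr (real p / real q) = s ^ p"
          by (simp only: s_pow)
        finally show ?thesis by simp
      qed
      have lt: "norm (z * of_real s) < 1" if "norm z \<le> 1" for z :: complex
      proof -
        have "norm (z * of_real s) \<le> 1 * s"
          using that s by (auto simp: norm_mult intro!: mult_right_mono)
        then show ?thesis using s by simp
      qed
      \<comment> \<open>The derivative of \<open>t\<close> to the power \<open>1 / q\<close>, written with \<open>s\<close> so that it supplies the
          factor \<open>s\<close> missing from \<open>w / (1 - w s)\<close> in the geometric sum over \<open>\<beta>\<close>.\<close>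
      have r_deriv: "(r has_real_derivative s / (real q * t)) (at t)"
        using has_real_derivative_powr[of t "1 / real q"] t
        by (simp add: r_def[abs_def] s_def powr_diff)
      have K: "((\<lambda>t. dilog_primitive (\<alpha> * a) (\<beta> * b) (of_real (r t))) has_vector_derivative
          Ln (1 - \<alpha> * (a * of_real s)) *
            (\<beta> * (b * of_real s) / (1 - \<beta> * (b * of_real s))) / of_real (real q * t)) (at t)"
        if "\<alpha> ^ p = 1" "\<beta> ^ q = 1" for \<alpha> \<beta>
      proof -
        have r_vec: "((\<lambda>t. complex_of_real (r t)) has_vector_derivative
            of_real (s / (real q * t))) (at t)"
          using r_deriv by (rule has_vector_derivative_of_real)
        have "(dilog_primitive (\<alpha> * a) (\<beta> * b) has_field_derivative
            Ln (1 - \<alpha> * a * of_real s) * (\<beta> * b / (1 - \<beta> * b * of_real s))) (at (of_real (r t)))"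
          unfolding s_def[symmetric] using s lt[OF A[OF that(1)]] lt[OF w(1)[OF that(2)]]
          by (intro dilog_primitive_deriv) auto
        from field_vector_diff_chain_at[OF r_vec this]
        show ?thesis by (simp add: o_def mult_ac)
      qed
      have "(M has_vector_derivative (\<Sum>\<alpha> | \<alpha> ^ p = 1. \<Sum>\<beta> | \<beta> ^ q = 1.
          Ln (1 - \<alpha> * (a * of_real s)) *
            (\<beta> * (b * of_real s) / (1 - \<beta> * (b * of_real s))) / of_real (real q * t))) (at t)"
        unfolding M_def[abs_def] by (intro has_vector_derivative_sum K) auto
      \<comment> \<open>Each summand is a product of a function of \<open>\<alpha>\<close> and a function of \<open>\<beta>\<close>.\<close>
      also have "(\<Sum>\<alpha> | \<alpha> ^ p = 1. \<Sum>\<beta> | \<beta> ^ q = 1. Ln (1 - \<alpha> * (a * of_real s)) *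
            (\<beta> * (b * of_real s) / (1 - \<beta> * (b * of_real s))) / of_real (real q * t)) =
          (\<Sum>\<alpha> | \<alpha> ^ p = 1. Ln (1 - \<alpha> * (a * of_real s))) *
          (\<Sum>\<beta> | \<beta> ^ q = 1. \<beta> * (b * of_real s) / (1 - \<beta> * (b * of_real s))) /
          of_real (real q * t)"
        unfolding sum_product by (simp add: sum_divide_distrib)
      also have "\<dots> = Ln (1 - (a * of_real s) ^ p) *
          (of_nat q * (b * of_real s) ^ q / (1 - (b * of_real s) ^ q)) / of_real (real q * t)"
        using assms(3,4) norm_a norm_b lt
        by (simp add: sum_Ln_roots_of_unity sum_geometric_roots_of_unity)
      also have "(b * of_real s) ^ q = v * of_real t"
        using s_q assms(6) by (simp add: power_mult_distrib of_real_power[symmetric])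
      also have "(a * of_real s) ^ p = u * of_real t powr (of_nat p / of_nat q)"
        using s_p assms(5) by (simp add: power_mult_distrib)
      also have "Ln (1 - u * of_real t powr (of_nat p / of_nat q)) *
          (of_nat q * (v * of_real t) / (1 - v * of_real t)) / of_real (real q * t) = f t"
      proof -
        have "norm (v * of_real t) < 1"
        proof -
          have "norm (v * of_real t) \<le> 1 * t"
            using assms(2) t by (auto simp: punctured_disc_def norm_mult intro!: mult_right_mono)
          then show ?thesis using t by simp
        qed
        then have "1 - v * of_real t \<noteq> 0" by auto
        moreover have "inverse v - of_real t = (1 - v * of_real t) / v"
          using \<open>v \<noteq> 0\<close> by (simp add: field_simps)
        ultimately show ?thesis using t assms(4) \<open>v \<noteq> 0\<close> by (simp add: f_def)
      qed
      finally show ?thesis .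
    qed
  qed simp
  then have "scriptF (of_nat p / of_nat q) u v = M 1 - M 0"
    unfolding scriptF_def f_def by (rule integral_unique)
  also have "M 0 = 0"
    using assms(4) by (simp add: M_def r_def dilog_primitive_0)
  also have "M 1 = (\<Sum>\<alpha> | \<alpha> ^ p = 1. \<Sum>\<beta> | \<beta> ^ q = 1. Li2 (\<alpha> * a) +
      (Li2 (\<beta> * b / (\<beta> * b - 1)) - Li2 ((\<alpha> * a - \<beta> * b) / (1 - \<beta> * b))))"
    by (simp add: M_def r_def dilog_primitive_def add_diff_eq)
  also have "\<dots> = of_nat q * (\<Sum>\<alpha> | \<alpha> ^ p = 1. Li2 (\<alpha> * a)) +
      (\<Sum>\<alpha> | \<alpha> ^ p = 1. \<Sum>\<beta> | \<beta> ^ q = 1.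
         Li2 (\<beta> * b / (\<beta> * b - 1)) - Li2 ((\<alpha> * a - \<beta> * b) / (1 - \<beta> * b)))"
    using assms(4) by (simp add: sum.distrib card_roots_unity_eq sum_distrib_left)
  also have "(\<Sum>\<alpha> | \<alpha> ^ p = 1. Li2 (\<alpha> * a)) = Li2 u / of_nat p"
    using sum_Li2_roots_of_unity[OF assms(3) norm_a] assms(5) by simp
  finally show ?thesis by simp
qed

end
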